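(* For any graph $G$, \[\alpha(G)\geq \sum_{v\in V(G)}\frac{2}{\deg(v)+c(v)+1}.\] Moreover, equality holds if and only if $G$ is the disjoint union of graphs $H_1,\ldots,H_k$ $(k\ge 1)$ such that each $H_i$ is a $\Delta(H_i)$-regular graph and \[\alpha(H_i)=\frac{2|H_i|}{\Delta(H_i)+\omega(H_i)+1}\qquad (1\le i\le k).\]
   Context: Graphs are finite, simple and have a nonempty vertex set. For a graph $G$: $\alpha(G)$ is the independence number, $\omega(G)$ the clique number, $\Delta(G)$ the maximum degree, $\deg(v)$ the degree of a vertex $v$ in $G$, and $c(v)$ is the number of vertices in a largest clique of $G$ containing the vertex $v$. $|H|$ denotes the number of vertices of a graph $H$. *)

theory Defs
  imports Complex_Main "HOL-Library.Disjoint_Sets" "Graph_Theory.Pair_Digraph"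
begin

text \<open>
  A \<^locale>\<open>pair_graph\<close> has a finite vertex set and a symmetric, loop-free arc relation; an
  undirected edge joining u and v is the pair of arcs (u, v) and (v, u).
\<close>

definition simple_graph :: "'a pair_pre_digraph \<Rightarrow> bool" where
  "simple_graph G \<longleftrightarrow> pair_graph G \<and> pverts G \<noteq> {}"

text \<open>Each undirected edge at v contributes exactly one arc leaving v.\<close>

definition degree :: "'a pair_pre_digraph \<Rightarrow> 'a \<Rightarrow> nat" where
  "degree G v = out_degree (with_proj G) v"

definition max_degree :: "'a pair_pre_digraph \<Rightarrow> nat" where
  "max_degree G = Max (degree G ` pverts G)"

definition regular :: "'a pair_pre_digraph \<Rightarrow> nat \<Rightarrow> bool" where
  "regular G d \<longleftrightarrow> (\<forall>v \<in> pverts G. degree G v = d)"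

definition independent_set :: "'a pair_pre_digraph \<Rightarrow> 'a set \<Rightarrow> bool" where
  "independent_set G S \<longleftrightarrow> S \<subseteq> pverts G \<and> (\<forall>u \<in> S. \<forall>v \<in> S. (u, v) \<notin> parcs G)"

definition clique :: "'a pair_pre_digraph \<Rightarrow> 'a set \<Rightarrow> bool" where
  "clique G K \<longleftrightarrow> K \<subseteq> pverts G \<and> (\<forall>u \<in> K. \<forall>v \<in> K. u \<noteq> v \<longrightarrow> (u, v) \<in> parcs G)"

definition independence_number :: "'a pair_pre_digraph \<Rightarrow> nat" where
  "independence_number G = Max (card ` {S. independent_set G S})"

definition clique_number :: "'a pair_pre_digraph \<Rightarrow> nat" where
  "clique_number G = Max (card ` {K. clique G K})"

definition clique_number_at :: "'a pair_pre_digraph \<Rightarrow> 'a \<Rightarrow> nat" where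
  "clique_number_at G v = Max (card ` {K. clique G K \<and> v \<in> K})"

text \<open>
  Internal disjoint union: the summands live on pairwise disjoint subsets of the vertex set
  of G, and every edge of G is an edge of one of them.
\<close>

definition is_disjoint_union ::
    "'a pair_pre_digraph \<Rightarrow> 'i set \<Rightarrow> ('i \<Rightarrow> 'a pair_pre_digraph) \<Rightarrow> bool" where
  "is_disjoint_union G I H \<longleftrightarrow>
     disjoint_family_on (\<lambda>i. pverts (H i)) I \<and>
     pverts G = (\<Union>i \<in> I. pverts (H i)) \<and>
     parcs G = (\<Union>i \<in> I. parcs (H i))"

end

theory Submission
  imports Defs
begin

text \<open>
  Let A be the adjacency matrix of G and M = A + I + diag(c). A Motzkin-Straus type inequality
  holds for M: every nonnegative w satisfies (2 / alpha) (sum w)^2 <= w^T M w. For the weights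
  w(v) = 1 / (deg(v) + c(v) + 1) the right-hand side is the sum of w minus half of the sum of
  (w(u) - w(v))^2 over the arcs, hence sum w <= alpha / 2.

  To prove the quadratic inequality, let x(v) be the probability that a uniformly random maximum
  independent set contains v. Then sum x = alpha and M x >= 2 in every coordinate. Subtracting from
  w the largest multiple t x that leaves w nonnegative does not increase
  w^T M w - (2 / alpha) (sum w)^2 and annihilates a coordinate, so one may induct on the number of
  vertices.

  In the case of equality w is constant along edges and M x = 2. The latter says that every vertex
  has at most two closed neighbours in each maximum independent set S, and that for s in S the
  vertices that can replace s in S form a largest clique at s. It follows that every vertex lies in
  some S and that c is constant along edges, hence so is the degree; the H_i are the classes of
  vertices with the same degree and c.
\<close>

section \<open>Maximum independent sets\<close>

definition nbhd :: "'a pair_pre_digraph \<Rightarrow> 'a \<Rightarrow> 'a set" where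
  "nbhd G v = {u. (v, u) \<in> parcs G}"

definition induced :: "'a pair_pre_digraph \<Rightarrow> 'a set \<Rightarrow> 'a pair_pre_digraph" where
  "induced G U = \<lparr>pverts = U, parcs = {(u, v) \<in> parcs G. u \<in> U \<and> v \<in> U}\<rparr>"

lemma pverts_induced [simp]: "pverts (induced G U) = U"
  and mem_parcs_induced [simp]: "(u, v) \<in> parcs (induced G U) \<longleftrightarrow> (u, v) \<in> parcs G \<and> u \<in> U \<and> v \<in> U"
  by (simp_all add: induced_def)

definition maximum_independent_sets :: "'a pair_pre_digraph \<Rightarrow> 'a set set" where
  "maximum_independent_sets G = {S. independent_set G S \<and> card S = independence_number G}"

text \<open>For an independent T these are the vertices by which T can be enlarged. With T = S - {v}
  and S maximum, they are the vertices that can replace v in S, v itself included.\<close>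

definition completions :: "'a pair_pre_digraph \<Rightarrow> 'a set \<Rightarrow> 'a set" where
  "completions G T = {k \<in> pverts G. k \<notin> T \<and> nbhd G k \<inter> T = {}}"

text \<open>For a vertex v, every other maximum independent set meets the closed neighbourhood of v
  at least twice. Counting these sets once more therefore brings the average number of hits up to
  two.\<close>

definition private_sets :: "'a pair_pre_digraph \<Rightarrow> 'a \<Rightarrow> 'a set set" where
  "private_sets G v = {S \<in> maximum_independent_sets G. card (S \<inter> insert v (nbhd G v)) = 1}"

definition sets_through :: "'a pair_pre_digraph \<Rightarrow> 'a \<Rightarrow> 'a set set" where
  "sets_through G v = {S \<in> maximum_independent_sets G. v \<in> S}"

definition marginal :: "'a pair_pre_digraph \<Rightarrow> 'a \<Rightarrow> real" where
  "marginal G v = real (card (sets_through G v)) / real (card (maximum_independent_sets G))"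

text \<open>The vector M w.\<close>

definition clique_op :: "'a pair_pre_digraph \<Rightarrow> ('a \<Rightarrow> real) \<Rightarrow> 'a \<Rightarrow> real" where
  "clique_op G w v = (real (clique_number_at G v) + 1) * w v + sum w (nbhd G v)"

text \<open>Finiteness of the arc set follows from that of the vertex set. In this form the graph
  axioms are easily checked for induced subgraphs.\<close>

lemma simple_graph_iff:
  "simple_graph G \<longleftrightarrow> finite (pverts G) \<and> pverts G \<noteq> {} \<and> parcs G \<subseteq> pverts G \<times> pverts G
     \<and> sym (parcs G) \<and> (\<forall>v. (v, v) \<notin> parcs G)"
proof
  assume "simple_graph G"
  then interpret pair_graph G by (simp add: simple_graph_def)
  show "finite (pverts G) \<and> pverts G \<noteq> {} \<and> parcs G \<subseteq> pverts G \<times> pverts G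
     \<and> sym (parcs G) \<and> (\<forall>v. (v, v) \<notin> parcs G)"
    using \<open>simple_graph G\<close> pair_finite_verts pair_sym_arcs pair_no_loops arc_fst_in_verts arc_snd_in_verts
    by (fastforce simp: simple_graph_def symmetric_def)
next
  assume *: "finite (pverts G) \<and> pverts G \<noteq> {} \<and> parcs G \<subseteq> pverts G \<times> pverts G
     \<and> sym (parcs G) \<and> (\<forall>v. (v, v) \<notin> parcs G)"
  then have "finite (parcs G)" by (meson finite_SigmaI finite_subset)
  with * have "pair_graph G"
    by unfold_locales (auto simp: symmetric_def)
  with * show "simple_graph G" by (simp add: simple_graph_def)
qed

lemma simple_graph_induced:
  assumes "simple_graph G" "U \<subseteq> pverts G" "U \<noteq> {}"
  shows "simple_graph (induced G U)"
  using assms by (auto simp: simple_graph_iff sym_def induced_def intro: finite_subset)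

lemma card_filter_eq_sum:
  "finite A \<Longrightarrow> card {x \<in> A. P x} = (\<Sum>x \<in> A. if P x then 1 else 0)"
  by (simp add: sum.inter_filter[symmetric])

lemma degree_eq_card_nbhd: "degree G v = card (nbhd G v)"
proof -
  have "out_arcs (with_proj G) v = Pair v ` nbhd G v"
    by (auto simp: out_arcs_def nbhd_def)
  then show ?thesis
    by (simp add: degree_def out_degree_def card_image inj_on_def)
qed

section \<open>Elementary facts on independent sets and cliques\<close>

context
  fixes G :: "'a pair_pre_digraph"
  assumes G: "simple_graph G"
begin

lemma finite_pverts: "finite (pverts G)"
  and pverts_nonempty: "pverts G \<noteq> {}"
  and arc_sym: "(u, v) \<in> parcs G \<Longrightarrow> (v, u) \<in> parcs G"
  and arc_irrefl: "(v, v) \<notin> parcs G"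
  and arc_pverts: "(u, v) \<in> parcs G \<Longrightarrow> u \<in> pverts G \<and> v \<in> pverts G"
  using G by (auto simp: simple_graph_iff sym_def)

lemma nbhd_subset: "nbhd G v \<subseteq> pverts G"
  using arc_pverts by (auto simp: nbhd_def)

lemma finite_nbhd: "finite (nbhd G v)"
  using nbhd_subset finite_pverts by (rule finite_subset)

lemma finite_independent_sets: "finite {S. independent_set G S}"
  by (rule finite_subset[of _ "Pow (pverts G)"]) (auto simp: independent_set_def finite_pverts)

lemma finite_cliques: "finite {K. clique G K}"
  by (rule finite_subset[of _ "Pow (pverts G)"]) (auto simp: clique_def finite_pverts)

lemma finite_independent_set: "independent_set G S \<Longrightarrow> finite S"
  using finite_pverts finite_subset by (auto simp: independent_set_def)

lemma card_le_independence_number: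
  "independent_set G S \<Longrightarrow> card S \<le> independence_number G"
  unfolding independence_number_def using finite_independent_sets by (intro Max_ge) auto

lemma maximum_independent_sets_nonempty: "maximum_independent_sets G \<noteq> {}"
proof -
  have "independent_set G {}" by (simp add: independent_set_def)
  then have "independence_number G \<in> card ` {S. independent_set G S}"
    unfolding independence_number_def using finite_independent_sets by (intro Max_in) auto
  then show ?thesis by (auto simp: maximum_independent_sets_def)
qed

lemma finite_maximum_independent_sets: "finite (maximum_independent_sets G)"
  by (rule finite_subset[OF _ finite_independent_sets]) (auto simp: maximum_independent_sets_def)

lemma independence_number_pos: "independence_number G > 0"
proof -
  obtain v where "v \<in> pverts G" using pverts_nonempty by blast
  then have "independent_set G {v}" by (simp add: independent_set_def arc_irrefl)
  then show ?thesis using card_le_independence_number by fastforce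
qed

lemma card_clique_le_clique_number_at:
  "clique G K \<Longrightarrow> v \<in> K \<Longrightarrow> card K \<le> clique_number_at G v"
  unfolding clique_number_at_def
  using finite_cliques by (intro Max_ge) auto

lemma clique_number_at_attained:
  assumes "v \<in> pverts G"
  obtains K where "clique G K" "v \<in> K" "card K = clique_number_at G v"
proof -
  have "clique G {v}" using assms by (simp add: clique_def)
  then have "clique_number_at G v \<in> card ` {K. clique G K \<and> v \<in> K}"
    unfolding clique_number_at_def using finite_cliques by (intro Max_in) auto
  then show thesis using that by auto
qed

lemma clique_number_at_le_clique_number:
  assumes "v \<in> pverts G"
  shows "clique_number_at G v \<le> clique_number G"
proof -
  obtain K where "clique G K" "card K = clique_number_at G v"
    using clique_number_at_attained[OF assms] by metis
  then show ?thesis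
    unfolding clique_number_def using finite_cliques by (metis Max_ge finite_imageI image_eqI mem_Collect_eq)
qed

section \<open>Swapping a vertex of a maximum independent set\<close>

lemma maximum_independent_setD:
  assumes "S \<in> maximum_independent_sets G"
  shows "independent_set G S" "card S = independence_number G" "finite S" "S \<subseteq> pverts G"
    "\<And>u v. u \<in> S \<Longrightarrow> v \<in> S \<Longrightarrow> (u, v) \<notin> parcs G"
  using assms finite_independent_set by (auto simp: maximum_independent_sets_def independent_set_def)

lemma mem_nbhd: "u \<in> nbhd G v \<longleftrightarrow> (v, u) \<in> parcs G"
  by (simp add: nbhd_def)

text \<open>Otherwise v could be added to S.\<close>

lemma maximum_independent_set_hits:
  assumes "S \<in> maximum_independent_sets G" "v \<in> pverts G"
  shows "S \<inter> insert v (nbhd G v) \<noteq> {}"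
proof
  assume *: "S \<inter> insert v (nbhd G v) = {}"
  note S = maximum_independent_setD[OF assms(1)]
  have "independent_set G (insert v S)"
    using * S(4,5) assms(2) arc_irrefl arc_sym by (auto simp: independent_set_def mem_nbhd)
  then show False using card_le_independence_number S(2,3) * by fastforce
qed

text \<open>Independence survives because k has no neighbour in the rest of S, and the size because
  k lies outside the rest. The case k = v is included.\<close>

lemma swap_completion:
  assumes S: "S \<in> maximum_independent_sets G" and v: "v \<in> S" and k: "k \<in> completions G (S - {v})"
  shows "insert k (S - {v}) \<in> maximum_independent_sets G"
proof -
  note S' = maximum_independent_setD[OF S]
  have "independent_set G (insert k (S - {v}))"
    using k S'(4,5) arc_irrefl arc_sym
    by (auto simp: independent_set_def completions_def disjoint_iff mem_nbhd)
  moreover have "card (insert k (S - {v})) = card S"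
    using k card_Suc_Diff1[OF S'(3) v] S'(3) by (simp add: completions_def)
  ultimately show ?thesis using S'(2) by (simp add: maximum_independent_sets_def)
qed

lemma mem_completions_self:
  assumes "S \<in> maximum_independent_sets G" "v \<in> S"
  shows "v \<in> completions G (S - {v})"
  using assms maximum_independent_setD[OF assms(1)] by (auto simp: completions_def mem_nbhd)

text \<open>If two completions j and k were not adjacent, k could be added to the maximum
  independent set obtained from S by replacing v by j.\<close>

lemma clique_completions:
  assumes S: "S \<in> maximum_independent_sets G" and v: "v \<in> S"
  shows "clique G (completions G (S - {v}))"
proof -
  have "(j, k) \<in> parcs G"
    if "j \<in> completions G (S - {v})" "k \<in> completions G (S - {v})" "j \<noteq> k" for j k
  proof (rule ccontr)
    assume *: "(j, k) \<notin> parcs G"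
    note S' = maximum_independent_setD[OF S]
    have j: "insert j (S - {v}) \<in> maximum_independent_sets G"
      using swap_completion[OF S v] that by blast
    have "insert j (S - {v}) \<inter> insert k (nbhd G k) = {}"
      using that * arc_sym by (auto simp: completions_def mem_nbhd)
    then show False
      using maximum_independent_set_hits[OF j] that by (auto simp: completions_def)
  qed
  then show ?thesis by (auto simp: clique_def completions_def)
qed

lemma finite_completions: "finite (completions G T)"
  using finite_pverts by (auto simp: completions_def)

lemma card_completions_le:
  assumes S: "S \<in> maximum_independent_sets G" and v: "v \<in> S" and "k \<in> completions G (S - {v})"
  shows "card (completions G (S - {v})) \<le> clique_number_at G k"
  using card_clique_le_clique_number_at clique_completions assms by blast

text \<open>Only v, being equal or adjacent to u, keeps u from being added to S.\<close>

lemma private_completion: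
  assumes "S \<in> maximum_independent_sets G" "v \<in> S" "u \<in> pverts G"
    "S \<inter> insert u (nbhd G u) = {v}"
  shows "u \<in> completions G (S - {v})"
  using assms by (auto simp: completions_def)

text \<open>A set meeting the closed neighbourhood of v in one vertex becomes a set through v by a swap;
  the sets with the same image differ in a completion.\<close>

lemma card_private_sets_le:
  assumes v: "v \<in> pverts G"
  shows "card (private_sets G v) \<le> (\<Sum>S \<in> sets_through G v. card (completions G (S - {v})))"
proof -
  have "private_sets G v \<subseteq> (\<Union>S \<in> sets_through G v. (\<lambda>k. insert k (S - {v})) ` completions G (S - {v}))"
  proof
    fix S assume "S \<in> private_sets G v"
    then have S: "S \<in> maximum_independent_sets G" and "card (S \<inter> insert v (nbhd G v)) = 1"
      by (auto simp: private_sets_def)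
    then obtain k where k: "S \<inter> insert v (nbhd G v) = {k}" by (meson card_1_singletonE)
    then have kS: "k \<in> S" by auto
    \<comment> \<open>The exchange of k for v is reversible: \<open>?S\<close> contains v, and k is
      a completion of \<open>?S - {v}\<close>, so S is one of the sets obtained from
      \<open>?S\<close>.\<close>
    let ?S = "insert v (S - {k})"
    have "v \<in> completions G (S - {k})"
      using private_completion[OF S kS v] k by simp
    then have "?S \<in> sets_through G v" and "?S - {v} = S - {k}"
      using swap_completion[OF S kS] by (auto simp: sets_through_def completions_def)
    moreover have "k \<in> completions G (S - {k})" using mem_completions_self[OF S kS] .
    ultimately show "S \<in> (\<Union>S \<in> sets_through G v. (\<lambda>k. insert k (S - {v})) ` completions G (S - {v}))"
      using kS by (intro UN_I[of ?S]) (auto simp: insert_absorb)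
  qed
  moreover have fin: "finite (sets_through G v)"
    using finite_maximum_independent_sets by (simp add: sets_through_def)
  ultimately have "card (private_sets G v) \<le>
      card (\<Union>S \<in> sets_through G v. (\<lambda>k. insert k (S - {v})) ` completions G (S - {v}))"
    by (intro card_mono) (auto intro: finite_completions)
  also have "\<dots> \<le> (\<Sum>S \<in> sets_through G v. card ((\<lambda>k. insert k (S - {v})) ` completions G (S - {v})))"
    by (rule card_UN_le[OF fin])
  also have "\<dots> \<le> (\<Sum>S \<in> sets_through G v. card (completions G (S - {v})))"
    by (intro sum_mono card_image_le finite_completions)
  finally show ?thesis .
qed

text \<open>Each of these sets of completions is a clique that contains v.\<close>

lemma sum_card_completions_le:
  "(\<Sum>S \<in> sets_through G v. card (completions G (S - {v}))) \<le> clique_number_at G v * card (sets_through G v)"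
proof -
  have "(\<Sum>S \<in> sets_through G v. card (completions G (S - {v}))) \<le> (\<Sum>S \<in> sets_through G v. clique_number_at G v)"
    by (intro sum_mono card_completions_le) (auto simp: sets_through_def intro: mem_completions_self)
  then show ?thesis by (simp add: mult.commute)
qed

text \<open>Double count of the pairs (u, S) in which u lies in S and in the closed neighbourhood of
  v.\<close>

lemma sum_card_hits:
  "(\<Sum>u \<in> insert v (nbhd G v). card (sets_through G u))
     = (\<Sum>S \<in> maximum_independent_sets G. card (S \<inter> insert v (nbhd G v)))"
proof -
  let ?I = "maximum_independent_sets G" and ?N = "insert v (nbhd G v)"
  have "(\<Sum>u \<in> ?N. card (sets_through G u)) = (\<Sum>u \<in> ?N. \<Sum>S \<in> ?I. if u \<in> S then 1 else 0)"
    unfolding sets_through_def by (simp add: card_filter_eq_sum[OF finite_maximum_independent_sets])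
  also have "\<dots> = (\<Sum>S \<in> ?I. \<Sum>u \<in> ?N. if u \<in> S then 1 else 0)"
    by (rule sum.swap)
  also have "\<dots> = (\<Sum>S \<in> ?I. card (S \<inter> ?N))"
  proof (rule sum.cong)
    fix S
    have "S \<inter> ?N = {u \<in> ?N. u \<in> S}" by blast
    then show "(\<Sum>u \<in> ?N. if u \<in> S then 1 else 0) = card (S \<inter> ?N)"
      using finite_nbhd by (simp only: card_filter_eq_sum finite_insert)
  qed simp
  finally show ?thesis .
qed

text \<open>A set with h hits contributes h, and one more if h = 1. Since h >= 1, each contribution
  is at least 2. If the total is exactly twice the number of sets, each contribution is 2, which
  excludes h > 2.\<close>

lemma sum_card_hits_ge:
  assumes v: "v \<in> pverts G"
  shows "2 * card (maximum_independent_sets G) \<le>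
    card (private_sets G v) + (\<Sum>S \<in> maximum_independent_sets G. card (S \<inter> insert v (nbhd G v)))"
    and "2 * card (maximum_independent_sets G) =
      card (private_sets G v) + (\<Sum>S \<in> maximum_independent_sets G. card (S \<inter> insert v (nbhd G v)))
      \<Longrightarrow> S \<in> maximum_independent_sets G \<Longrightarrow> card (S \<inter> insert v (nbhd G v)) \<le> 2"
proof -
  let ?I = "maximum_independent_sets G" and ?h = "\<lambda>S. card (S \<inter> insert v (nbhd G v))"
  let ?p = "\<lambda>S. (if ?h S = 1 then 1 else 0) + ?h S"
  have eq: "card (private_sets G v) + (\<Sum>S \<in> ?I. ?h S) = (\<Sum>S \<in> ?I. ?p S)"
    unfolding private_sets_def
    by (simp only: card_filter_eq_sum[OF finite_maximum_independent_sets] sum.distrib)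
  have ge: "2 \<le> ?p S" if "S \<in> ?I" for S
  proof -
    have "?h S > 0"
      using maximum_independent_set_hits[OF that v] maximum_independent_setD(3)[OF that]
      by (simp add: card_gt_0_iff)
    then show ?thesis by (cases "?h S = 1") auto
  qed
  then have "(\<Sum>S \<in> ?I. 2) \<le> (\<Sum>S \<in> ?I. ?p S)" by (intro sum_mono)
  then show "2 * card ?I \<le> card (private_sets G v) + (\<Sum>S \<in> ?I. ?h S)"
    using eq by simp
  assume "2 * card ?I = card (private_sets G v) + (\<Sum>S \<in> ?I. ?h S)" and S: "S \<in> ?I"
  then have *: "(\<Sum>S \<in> ?I. 2) = (\<Sum>S \<in> ?I. ?p S)" using eq by simp
  have "2 = ?p S"
  proof (rule ccontr)
    assume "2 \<noteq> ?p S"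
    then have "2 < ?p S" using ge[OF S] by simp
    then have "(\<Sum>S \<in> ?I. 2) < (\<Sum>S \<in> ?I. ?p S)"
      using ge S finite_maximum_independent_sets by (intro sum_strict_mono_ex1) blast+
    then show False using * by simp
  qed
  then show "?h S \<le> 2" by simp
qed

section \<open>The uniformly random maximum independent set\<close>

lemma card_maximum_independent_sets_pos: "card (maximum_independent_sets G) > 0"
  using maximum_independent_sets_nonempty finite_maximum_independent_sets by (simp add: card_gt_0_iff)

lemma marginal_nonneg: "marginal G v \<ge> 0"
  by (simp add: marginal_def)

text \<open>Both sides are the expected size of a random maximum independent set.\<close>

lemma sum_marginal: "sum (marginal G) (pverts G) = independence_number G"
proof -
  let ?I = "maximum_independent_sets G"
  have "(\<Sum>v \<in> pverts G. card (sets_through G v)) = (\<Sum>v \<in> pverts G. \<Sum>S \<in> ?I. if v \<in> S then 1 else 0)"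
    unfolding sets_through_def by (simp add: card_filter_eq_sum[OF finite_maximum_independent_sets])
  also have "\<dots> = (\<Sum>S \<in> ?I. \<Sum>v \<in> pverts G. if v \<in> S then 1 else 0)"
    by (rule sum.swap)
  also have "\<dots> = (\<Sum>S \<in> ?I. independence_number G)"
  proof (rule sum.cong)
    fix S assume "S \<in> ?I"
    then have "S = {v \<in> pverts G. v \<in> S}" "card S = independence_number G"
      using maximum_independent_setD by blast+
    then show "(\<Sum>v \<in> pverts G. if v \<in> S then 1 else 0) = independence_number G"
      using card_filter_eq_sum[OF finite_pverts, of "\<lambda>v. v \<in> S"] by simp
  qed simp
  finally have "real (\<Sum>v \<in> pverts G. card (sets_through G v)) = real (card ?I * independence_number G)"
    by simp
  then show ?thesis
    using card_maximum_independent_sets_pos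
    by (simp add: marginal_def sum_divide_distrib[symmetric])
qed

text \<open>Clears the denominator of \<open>marginal\<close>, so that the counting bounds apply
  over the natural numbers. The summand 1 in the diagonal entry c(v) + 1 of M turns the
  neighbourhood of v into the closed one.\<close>

lemma clique_op_marginal:
  "clique_op G (marginal G) v * card (maximum_independent_sets G) =
    real (clique_number_at G v * card (sets_through G v)
      + (\<Sum>S \<in> maximum_independent_sets G. card (S \<inter> insert v (nbhd G v))))"
proof -
  have "v \<notin> nbhd G v" by (simp add: mem_nbhd arc_irrefl)
  then show ?thesis
    unfolding sum_card_hits[symmetric]
    using card_maximum_independent_sets_pos finite_nbhd
    by (simp add: clique_op_def marginal_def sum_divide_distrib[symmetric] field_simps)
qed

text \<open>If n is the number of maximum independent sets, 2 n is at most the number of private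
  sets plus the number of hits, and there are at most c(v) times as many private sets as sets
  through v.\<close>

lemma clique_op_marginal_ge:
  assumes "v \<in> pverts G"
  shows "clique_op G (marginal G) v \<ge> 2"
proof -
  let ?n = "card (maximum_independent_sets G)"
  have "2 * ?n \<le> clique_number_at G v * card (sets_through G v)
      + (\<Sum>S \<in> maximum_independent_sets G. card (S \<inter> insert v (nbhd G v)))"
    using sum_card_hits_ge(1)[OF assms] card_private_sets_le[OF assms] sum_card_completions_le[of v]
    by linarith
  then have "real (2 * ?n) \<le> clique_op G (marginal G) v * ?n"
    unfolding clique_op_marginal of_nat_le_iff .
  then show ?thesis using card_maximum_independent_sets_pos by simp
qed

text \<open>Equality at the end of the chain behind \<open>clique_op_marginal_ge\<close> forces
  equality in each of its links: no set has more than two hits, and the completions of each set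
  through v attain the bound c(v).\<close>

lemma clique_op_marginal_tight:
  assumes v: "v \<in> pverts G" and tight: "clique_op G (marginal G) v = 2"
  shows "S \<in> maximum_independent_sets G \<Longrightarrow> card (S \<inter> insert v (nbhd G v)) \<le> 2"
    and "S \<in> maximum_independent_sets G \<Longrightarrow> v \<in> S \<Longrightarrow> card (completions G (S - {v})) = clique_number_at G v"
proof -
  let ?n = "card (maximum_independent_sets G)"
  let ?c = "\<lambda>S. card (completions G (S - {v}))"
  have "real (2 * ?n) = real (clique_number_at G v * card (sets_through G v)
      + (\<Sum>S \<in> maximum_independent_sets G. card (S \<inter> insert v (nbhd G v))))"
    using clique_op_marginal[of v] tight by simp
  then have "2 * ?n = clique_number_at G v * card (sets_through G v)
      + (\<Sum>S \<in> maximum_independent_sets G. card (S \<inter> insert v (nbhd G v)))"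
    using of_nat_eq_iff by blast
  then have *: "2 * ?n = card (private_sets G v)
      + (\<Sum>S \<in> maximum_independent_sets G. card (S \<inter> insert v (nbhd G v)))"
    "(\<Sum>S \<in> sets_through G v. ?c S) = clique_number_at G v * card (sets_through G v)"
    using sum_card_hits_ge(1)[OF v] card_private_sets_le[OF v] sum_card_completions_le[of v]
    by linarith+
  show "S \<in> maximum_independent_sets G \<Longrightarrow> card (S \<inter> insert v (nbhd G v)) \<le> 2"
    using sum_card_hits_ge(2)[OF v *(1)] .
  assume "S \<in> maximum_independent_sets G" "v \<in> S"
  then have S: "S \<in> sets_through G v" by (simp add: sets_through_def)
  have le: "?c S \<le> clique_number_at G v" if "S \<in> sets_through G v" for S
    using that by (intro card_completions_le) (auto simp: sets_through_def intro: mem_completions_self)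
  have fin: "finite (sets_through G v)"
    using finite_maximum_independent_sets by (simp add: sets_through_def)
  show "?c S = clique_number_at G v"
  proof (rule ccontr)
    assume "?c S \<noteq> clique_number_at G v"
    with le[OF S] have "?c S < clique_number_at G v" by simp
    with S le have "(\<Sum>S \<in> sets_through G v. ?c S) < (\<Sum>S \<in> sets_through G v. clique_number_at G v)"
      by (intro sum_strict_mono_ex1[OF fin]) blast+
    with *(2) show False by (simp add: mult.commute)
  qed
qed

section \<open>The quadratic inequality\<close>

text \<open>Turning every arc around permutes the arcs, as they come in opposite pairs.\<close>

lemma sum_arcs_swap:
  fixes h :: "'a \<Rightarrow> 'a \<Rightarrow> real"
  shows "(\<Sum>v \<in> pverts G. \<Sum>u \<in> nbhd G v. h v u) = (\<Sum>v \<in> pverts G. \<Sum>u \<in> nbhd G v. h u v)"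
proof -
  have "nbhd G v = {u \<in> pverts G. (v, u) \<in> parcs G}" "nbhd G v = {u \<in> pverts G. (u, v) \<in> parcs G}" for v
    using arc_pverts arc_sym by (auto simp: mem_nbhd)
  then show ?thesis
    using sum.swap_restrict[OF finite_pverts finite_pverts, of h "\<lambda>v u. (v, u) \<in> parcs G"] by simp
qed

text \<open>This is the symmetry of the matrix M.\<close>

lemma clique_op_self_adjoint:
  "(\<Sum>v \<in> pverts G. f v * clique_op G g v) = (\<Sum>v \<in> pverts G. g v * clique_op G f v)"
  using sum_arcs_swap[of "\<lambda>v u. f v * g u"]
  by (simp add: clique_op_def algebra_simps sum.distrib sum_distrib_left)

text \<open>For Q(w) = alpha w^T M w - 2 (sum w)^2, symmetry of M gives Q(w) - Q(w') = alpha (w +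
  w')^T M (w - w') - 2 (sum w + sum w') (sum w - sum w'). Here w - w' = t x with x =
  \<open>marginal G\<close> and sum x = alpha, so a factor alpha t comes out.\<close>

lemma quadratic_form_peel:
  fixes t :: real
  assumes w: "\<And>v. v \<in> pverts G \<Longrightarrow> w v = w' v + t * marginal G v"
  shows "independence_number G * (\<Sum>v \<in> pverts G. w v * clique_op G w v) - 2 * (sum w (pverts G))\<^sup>2 =
    independence_number G * (\<Sum>v \<in> pverts G. w' v * clique_op G w' v) - 2 * (sum w' (pverts G))\<^sup>2
    + independence_number G * t * (\<Sum>v \<in> pverts G. (w' v + w v) * (clique_op G (marginal G) v - 2))"
proof -
  let ?x = "marginal G" and ?V = "pverts G" and ?a = "real (independence_number G)"
  have sum_w: "sum w ?V = sum w' ?V + t * ?a"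
    using w by (simp add: sum.distrib sum_distrib_left[symmetric] sum_marginal)
  have "clique_op G w v = clique_op G w' v + t * clique_op G ?x v" if "v \<in> ?V" for v
  proof -
    have "sum w (nbhd G v) = sum w' (nbhd G v) + t * sum ?x (nbhd G v)"
      using w nbhd_subset[of v] by (simp add: subset_iff sum.distrib sum_distrib_left[symmetric])
    then show ?thesis using w[OF that] by (simp add: clique_op_def algebra_simps)
  qed
  then have "(\<Sum>v \<in> ?V. w v * clique_op G w v) =
      (\<Sum>v \<in> ?V. (w' v + t * ?x v) * (clique_op G w' v + t * clique_op G ?x v))"
    using w by (intro sum.cong) auto
  also have "\<dots> = (\<Sum>v \<in> ?V. w' v * clique_op G w' v) + t * (\<Sum>v \<in> ?V. w' v * clique_op G ?x v)
      + t * (\<Sum>v \<in> ?V. ?x v * clique_op G w' v) + t * t * (\<Sum>v \<in> ?V. ?x v * clique_op G ?x v)"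
    by (simp add: algebra_simps sum.distrib sum_distrib_left)
  also have "(\<Sum>v \<in> ?V. ?x v * clique_op G w' v) = (\<Sum>v \<in> ?V. w' v * clique_op G ?x v)"
    by (rule clique_op_self_adjoint)
  finally have q: "(\<Sum>v \<in> ?V. w v * clique_op G w v) = (\<Sum>v \<in> ?V. w' v * clique_op G w' v)
      + 2 * t * (\<Sum>v \<in> ?V. w' v * clique_op G ?x v) + t * t * (\<Sum>v \<in> ?V. ?x v * clique_op G ?x v)"
    by simp
  have "(\<Sum>v \<in> ?V. (w' v + w v) * (clique_op G ?x v - 2)) =
      (\<Sum>v \<in> ?V. (2 * w' v + t * ?x v) * (clique_op G ?x v - 2))"
    using w by (intro sum.cong) auto
  also have "\<dots> = 2 * (\<Sum>v \<in> ?V. w' v * clique_op G ?x v) + t * (\<Sum>v \<in> ?V. ?x v * clique_op G ?x v)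
      - 4 * sum w' ?V - 2 * t * sum ?x ?V"
    by (simp add: algebra_simps sum.distrib sum_distrib_left sum_distrib_right sum_subtractf)
  also have "\<dots> = 2 * (\<Sum>v \<in> ?V. w' v * clique_op G ?x v) + t * (\<Sum>v \<in> ?V. ?x v * clique_op G ?x v)
      - 4 * sum w' ?V - 2 * t * ?a"
    by (simp add: sum_marginal)
  finally have d: "(\<Sum>v \<in> ?V. (w' v + w v) * (clique_op G ?x v - 2)) = 2 * (\<Sum>v \<in> ?V. w' v * clique_op G ?x v)
      + t * (\<Sum>v \<in> ?V. ?x v * clique_op G ?x v) - 4 * sum w' ?V - 2 * t * ?a" .
  show ?thesis unfolding q sum_w d by (simp add: algebra_simps power2_eq_square)
qed

text \<open>The factor t is the least ratio of w to x = \<open>marginal G\<close> over the vertices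
  with x > 0, and v0 attains it. Such vertices exist, since x sums to alpha > 0. Where x vanishes,
  the bound on t x is just w >= 0.\<close>

lemma peel:
  assumes "\<And>v. v \<in> pverts G \<Longrightarrow> w v \<ge> 0"
  obtains t v\<^sub>0 where "t \<ge> 0" "v\<^sub>0 \<in> pverts G" "w v\<^sub>0 = t * marginal G v\<^sub>0"
    "\<And>v. v \<in> pverts G \<Longrightarrow> t * marginal G v \<le> w v"
    "(\<And>v. v \<in> pverts G \<Longrightarrow> w v > 0) \<Longrightarrow> t > 0"
proof -
  let ?x = "marginal G"
  let ?P = "{v \<in> pverts G. ?x v > 0}"
  have "?P \<noteq> {}"
  proof
    assume "?P = {}"
    then have "sum ?x (pverts G) = 0"
      using marginal_nonneg by (intro sum.neutral) (auto simp: less_le)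
    then show False using sum_marginal independence_number_pos by simp
  qed
  moreover have fin: "finite ?P" using finite_pverts by simp
  ultimately have "Min ((\<lambda>v. w v / ?x v) ` ?P) \<in> (\<lambda>v. w v / ?x v) ` ?P"
    by (intro Min_in) auto
  then obtain v\<^sub>0 where v\<^sub>0: "v\<^sub>0 \<in> ?P" and "w v\<^sub>0 / ?x v\<^sub>0 = Min ((\<lambda>v. w v / ?x v) ` ?P)"
    by auto
  then have min: "w v\<^sub>0 / ?x v\<^sub>0 \<le> w v / ?x v" if "v \<in> ?P" for v
    using that fin by (metis (no_types, lifting) Min_le finite_imageI imageI)
  show thesis
  proof (rule that[of "w v\<^sub>0 / ?x v\<^sub>0" v\<^sub>0])
    show "w v\<^sub>0 / ?x v\<^sub>0 * ?x v \<le> w v" if "v \<in> pverts G" for v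
    proof (cases "?x v > 0")
      case True
      then show ?thesis using min[of v] that by (simp add: pos_le_divide_eq)
    next
      case False
      then have "?x v = 0" using marginal_nonneg[of v] by simp
      then show ?thesis using assms[OF that] by simp
    qed
  qed (use v\<^sub>0 assms in auto)
qed

end

section \<open>Induced subgraphs and the Motzkin-Straus type inequality\<close>

lemma independent_set_induced_iff:
  assumes "U \<subseteq> pverts G"
  shows "independent_set (induced G U) S \<longleftrightarrow> S \<subseteq> U \<and> independent_set G S"
  unfolding independent_set_def pverts_induced mem_parcs_induced using assms by (meson subsetD subset_trans)

lemma clique_induced_iff:
  assumes "U \<subseteq> pverts G"
  shows "clique (induced G U) K \<longleftrightarrow> K \<subseteq> U \<and> clique G K"
  unfolding clique_def pverts_induced mem_parcs_induced using assms by (meson subsetD subset_trans)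

lemma independence_number_induced_le:
  assumes "simple_graph G" "U \<subseteq> pverts G" "U \<noteq> {}"
  shows "independence_number (induced G U) \<le> independence_number G"
proof -
  note H = simple_graph_induced[OF assms]
  obtain S where "S \<in> maximum_independent_sets (induced G U)"
    using maximum_independent_sets_nonempty[OF H] by blast
  then have S: "independent_set (induced G U) S" and card: "card S = independence_number (induced G U)"
    by (simp_all add: maximum_independent_sets_def)
  from S have "independent_set G S"
    using independent_set_induced_iff[OF assms(2)] by blast
  then show ?thesis using card_le_independence_number[OF assms(1)] card by force
qed

lemma clique_number_at_induced_le:
  assumes "simple_graph G" "U \<subseteq> pverts G" "v \<in> U"
  shows "clique_number_at (induced G U) v \<le> clique_number_at G v"
proof -
  have H: "simple_graph (induced G U)" using simple_graph_induced assms by blast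
  obtain K where K: "clique (induced G U) K" "v \<in> K" "card K = clique_number_at (induced G U) v"
    by (rule clique_number_at_attained[OF H, of v]) (use assms(3) in simp)
  then have "clique G K" using clique_induced_iff[OF assms(2)] by blast
  then show ?thesis using card_clique_le_clique_number_at[OF assms(1) _ K(2)] K(3) by simp
qed

text \<open>The classical Motzkin-Straus theorem, stated for independent sets, has A + I and 1 /
  alpha in place of M and 2 / alpha. Since M x >= 2, the correction term of
  \<open>quadratic_form_peel\<close> is nonnegative, so it suffices to treat w' = w - t x. As w'
  vanishes at v0, this reduces to the graph without v0.\<close>

lemma motzkin_straus_local:
  assumes "simple_graph G" "\<And>v. v \<in> pverts G \<Longrightarrow> w v \<ge> 0"
  shows "2 * (sum w (pverts G))\<^sup>2 \<le> independence_number G * (\<Sum>v \<in> pverts G. w v * clique_op G w v)"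
  using assms
proof (induction "card (pverts G)" arbitrary: G w rule: less_induct)
  case less
  let ?V = "pverts G" and ?x = "marginal G"
  note G = less.prems(1)
  obtain t v\<^sub>0 where t: "t \<ge> 0" and v\<^sub>0: "v\<^sub>0 \<in> ?V" "w v\<^sub>0 = t * ?x v\<^sub>0"
    and le: "\<And>v. v \<in> ?V \<Longrightarrow> t * ?x v \<le> w v"
    by (rule peel[OF G, of w]) (use less.prems(2) in blast)+
  define w' where "w' v = w v - t * ?x v" for v
  have w': "w' v \<ge> 0" if "v \<in> ?V" for v using le[OF that] by (simp add: w'_def)
  have w'0: "w' v\<^sub>0 = 0" using v\<^sub>0 by (simp add: w'_def)
  let ?U = "?V - {v\<^sub>0}"
  have sum_V: "(\<Sum>v \<in> ?V. h v) = (\<Sum>v \<in> ?U. h v)" if "h v\<^sub>0 = 0" for h :: "'a \<Rightarrow> real"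
    using v\<^sub>0(1) finite_pverts[OF G] that by (simp add: sum.remove)
  have "2 * (sum w' ?V)\<^sup>2 \<le> independence_number G * (\<Sum>v \<in> ?V. w' v * clique_op G w' v)"
  \<comment> \<open>A graph must have a vertex, so a one-vertex G is settled without the induction
    hypothesis: there w' is zero.\<close>
  proof (cases "?U = {}")
    case True
    then have "?V = {v\<^sub>0}" using v\<^sub>0(1) by blast
    then show ?thesis using w'0 by simp
  next
    case False
    let ?H = "induced G ?U"
    have H: "simple_graph ?H" by (rule simple_graph_induced[OF G Diff_subset False])
    have "card ?U < card ?V" using v\<^sub>0(1) finite_pverts[OF G] by (meson card_Diff1_less)
    then have "2 * (sum w' ?U)\<^sup>2 \<le> independence_number ?H * (\<Sum>v \<in> ?U. w' v * clique_op ?H w' v)"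
      using less.hyps[of ?H w'] H w' by simp
    \<comment> \<open>Putting v0 back can only raise alpha and the numbers c(v). The sums over
      neighbourhoods do not change, as w' is zero at v0.\<close>
    also have "\<dots> \<le> independence_number G * (\<Sum>v \<in> ?U. w' v * clique_op G w' v)"
    proof (rule mult_mono)
      have nb: "nbhd ?H v = nbhd G v - {v\<^sub>0}" if "v \<in> ?U" for v
        using that arc_pverts[OF G, of v] by (simp add: nbhd_def set_eq_iff) blast
      have sum_nb: "sum w' (nbhd ?H v) = sum w' (nbhd G v)" if "v \<in> ?U" for v
        unfolding nb[OF that] using w'0 finite_nbhd[OF G] by (intro sum.mono_neutral_left) auto
      have sum_nb_nonneg: "sum w' (nbhd ?H v) \<ge> 0" if "v \<in> ?U" for v
        unfolding sum_nb[OF that] using w' nbhd_subset[OF G, of v] by (intro sum_nonneg) blast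
      show "(\<Sum>v \<in> ?U. w' v * clique_op ?H w' v) \<le> (\<Sum>v \<in> ?U. w' v * clique_op G w' v)"
      proof (rule sum_mono)
        fix v assume v: "v \<in> ?U"
        have "clique_number_at ?H v \<le> clique_number_at G v"
          by (rule clique_number_at_induced_le[OF G Diff_subset v])
        then have "clique_op ?H w' v \<le> clique_op G w' v"
          using w'[of v] v sum_nb[OF v] by (simp add: clique_op_def mult_right_mono)
        then show "w' v * clique_op ?H w' v \<le> w' v * clique_op G w' v"
          using w'[of v] v by (simp add: mult_left_mono)
      qed
      show "0 \<le> (\<Sum>v \<in> ?U. w' v * clique_op ?H w' v)"
        using w' sum_nb_nonneg by (intro sum_nonneg mult_nonneg_nonneg) (simp_all add: clique_op_def)
      show "real (independence_number ?H) \<le> real (independence_number G)"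
        using independence_number_induced_le[OF G Diff_subset False] by simp
    qed simp
    finally show ?thesis using w'0 by (simp add: sum_V)
  qed
  moreover have "0 \<le> real (independence_number G) * t * (\<Sum>v \<in> ?V. (w' v + w v) * (clique_op G ?x v - 2))"
    using t w' less.prems(2) clique_op_marginal_ge[OF G]
    by (intro mult_nonneg_nonneg sum_nonneg) auto
  ultimately show ?case
    using quadratic_form_peel[OF G, of w w' t] by (simp add: w'_def)
qed

text \<open>Positivity of w makes both t and w' + w positive. Equality for w and the inequality for
  w' leave no room for the correction term of \<open>quadratic_form_peel\<close>, whose summands are
  nonnegative and therefore zero.\<close>

lemma motzkin_straus_local_tight:
  assumes G: "simple_graph G" and w: "\<And>v. v \<in> pverts G \<Longrightarrow> w v > 0"
    and eq: "2 * (sum w (pverts G))\<^sup>2 = independence_number G * (\<Sum>v \<in> pverts G. w v * clique_op G w v)"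
    and v: "v \<in> pverts G"
  shows "clique_op G (marginal G) v = 2"
proof -
  let ?V = "pverts G" and ?x = "marginal G"
  have "\<And>v. v \<in> ?V \<Longrightarrow> w v \<ge> 0" using w by (simp add: less_imp_le)
  then obtain t where "(\<And>v. v \<in> ?V \<Longrightarrow> w v > 0) \<Longrightarrow> t > 0" and le: "\<And>v. v \<in> ?V \<Longrightarrow> t * ?x v \<le> w v"
    by (rule peel[OF G, of w]) blast+
  then have t: "t > 0" using w by blast
  define w' where "w' v = w v - t * ?x v" for v
  have w': "w' v \<ge> 0" if "v \<in> ?V" for v using le[OF that] by (simp add: w'_def)
  have nonneg: "0 \<le> (w' v + w v) * (clique_op G ?x v - 2)" if "v \<in> ?V" for v
    using w'[OF that] w[OF that] clique_op_marginal_ge[OF G that] by simp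
  have "2 * (sum w' ?V)\<^sup>2 \<le> independence_number G * (\<Sum>v \<in> ?V. w' v * clique_op G w' v)"
    using motzkin_straus_local[OF G] w' by blast
  then have "real (independence_number G) * t * (\<Sum>v \<in> ?V. (w' v + w v) * (clique_op G ?x v - 2)) \<le> 0"
    using quadratic_form_peel[OF G, of w w' t] eq by (simp add: w'_def)
  then have "(\<Sum>v \<in> ?V. (w' v + w v) * (clique_op G ?x v - 2)) \<le> 0"
    using t independence_number_pos[OF G] by (simp add: mult_le_0_iff)
  then have "(\<Sum>v \<in> ?V. (w' v + w v) * (clique_op G ?x v - 2)) = 0"
    using nonneg by (meson order_antisym sum_nonneg)
  then have "(w' v + w v) * (clique_op G ?x v - 2) = 0"
    using nonneg v finite_pverts[OF G] by (simp add: sum_nonneg_eq_0_iff)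
  then show ?thesis using w'[OF v] w[OF v] by simp
qed

text \<open>Expand (w(v) - w(u))^2 over all arcs. Each of the two sums of squares equals the sum of
  deg(v) w(v)^2, and the mixed products give the adjacency part of the form.\<close>

lemma sum_clique_op_eq:
  assumes G: "simple_graph G"
  shows "(\<Sum>v \<in> pverts G. w v * clique_op G w v) =
    (\<Sum>v \<in> pverts G. (real (degree G v) + real (clique_number_at G v) + 1) * (w v)\<^sup>2)
    - (\<Sum>v \<in> pverts G. \<Sum>u \<in> nbhd G v. (w v - w u)\<^sup>2) / 2"
proof -
  let ?V = "pverts G"
  have *: "(\<Sum>v \<in> ?V. \<Sum>u \<in> nbhd G v. (w u)\<^sup>2) = (\<Sum>v \<in> ?V. degree G v * (w v)\<^sup>2)"
    using sum_arcs_swap[OF G, of "\<lambda>v u. (w u)\<^sup>2"] by (simp add: degree_eq_card_nbhd)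
  have "(\<Sum>v \<in> ?V. \<Sum>u \<in> nbhd G v. (w v - w u)\<^sup>2) =
      (\<Sum>v \<in> ?V. \<Sum>u \<in> nbhd G v. (w v)\<^sup>2) + (\<Sum>v \<in> ?V. \<Sum>u \<in> nbhd G v. (w u)\<^sup>2)
      - 2 * (\<Sum>v \<in> ?V. \<Sum>u \<in> nbhd G v. w v * w u)"
    by (simp add: power2_diff sum.distrib sum_subtractf sum_distrib_left mult.assoc)
  also have "\<dots> = 2 * (\<Sum>v \<in> ?V. degree G v * (w v)\<^sup>2) - 2 * (\<Sum>v \<in> ?V. w v * sum w (nbhd G v))"
    unfolding * by (simp add: degree_eq_card_nbhd sum_distrib_left)
  finally have "(\<Sum>v \<in> ?V. \<Sum>u \<in> nbhd G v. (w v - w u)\<^sup>2) / 2 =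
      (\<Sum>v \<in> ?V. degree G v * (w v)\<^sup>2) - (\<Sum>v \<in> ?V. w v * sum w (nbhd G v))"
    by simp
  moreover have "(\<Sum>v \<in> ?V. w v * clique_op G w v) =
      (\<Sum>v \<in> ?V. (real (clique_number_at G v) + 1) * (w v)\<^sup>2) + (\<Sum>v \<in> ?V. w v * sum w (nbhd G v))"
    by (simp add: clique_op_def distrib_left sum.distrib power2_eq_square mult.left_commute)
  moreover have "(\<Sum>v \<in> ?V. (real (degree G v) + real (clique_number_at G v) + 1) * (w v)\<^sup>2) =
      (\<Sum>v \<in> ?V. degree G v * (w v)\<^sup>2) + (\<Sum>v \<in> ?V. (real (clique_number_at G v) + 1) * (w v)\<^sup>2)"
    by (simp add: distrib_right sum.distrib)
  ultimately show ?thesis by linarith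
qed

section \<open>The weights and the lower bound on the independence number\<close>

definition weight :: "'a pair_pre_digraph \<Rightarrow> 'a \<Rightarrow> real" where
  "weight G v = 1 / (real (degree G v) + real (clique_number_at G v) + 1)"

lemma weight_pos: "weight G v > 0"
  by (simp add: weight_def add_nonneg_pos)

text \<open>The weight is chosen so that (deg(v) + c(v) + 1) w(v)^2 = w(v). Its sum is half the sum
  in the theorem.\<close>

lemma sum_weight_clique_op:
  assumes "simple_graph G"
  shows "(\<Sum>v \<in> pverts G. weight G v * clique_op G (weight G) v) =
    sum (weight G) (pverts G) - (\<Sum>v \<in> pverts G. \<Sum>u \<in> nbhd G v. (weight G v - weight G u)\<^sup>2) / 2"
proof -
  have "(real (degree G v) + real (clique_number_at G v) + 1) * (weight G v)\<^sup>2 = weight G v" for v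
  proof -
    have "(real (degree G v) + real (clique_number_at G v) + 1) * weight G v = 1"
      using weight_pos[of G v] by (simp add: weight_def)
    then show ?thesis by (simp add: power2_eq_square mult.assoc[symmetric])
  qed
  then show ?thesis using sum_clique_op_eq[OF assms, of "weight G"] by simp
qed

lemma sum_weight_pos:
  assumes "simple_graph G"
  shows "sum (weight G) (pverts G) > 0"
  by (intro sum_pos finite_pverts[OF assms] pverts_nonempty[OF assms] weight_pos)

text \<open>With W the sum of the weights, 2 W^2 <= alpha w^T M w <= alpha W, and W > 0 can be
  cancelled.\<close>

lemma sum_weight_le:
  assumes G: "simple_graph G"
  shows "2 * sum (weight G) (pverts G) \<le> independence_number G"
proof -
  let ?W = "sum (weight G) (pverts G)"
  have "2 * ?W\<^sup>2 \<le> independence_number G * (\<Sum>v \<in> pverts G. weight G v * clique_op G (weight G) v)"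
    by (intro motzkin_straus_local[OF G] less_imp_le[OF weight_pos])
  also have "\<dots> \<le> independence_number G * ?W"
    unfolding sum_weight_clique_op[OF G] by (intro mult_left_mono) (simp_all add: sum_nonneg)
  finally have "(2 * ?W) * ?W \<le> independence_number G * ?W" by (simp add: power2_eq_square)
  then show ?thesis using sum_weight_pos[OF G] by (simp add: mult_le_cancel_right)
qed

text \<open>With alpha = 2 W the quadratic inequality reads 2 W^2 <= 2 W^2 - W D, where D >= 0 is
  the sum of the squared differences over the arcs. Hence D = 0, which makes the weight constant
  along arcs and the quadratic inequality an equality.\<close>

lemma sum_weight_tight:
  assumes G: "simple_graph G" and eq: "2 * sum (weight G) (pverts G) = independence_number G"
  shows "(v, u) \<in> parcs G \<Longrightarrow> weight G v = weight G u"
    and "v \<in> pverts G \<Longrightarrow> clique_op G (marginal G) v = 2"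
proof -
  let ?W = "sum (weight G) (pverts G)"
  let ?D = "\<Sum>v \<in> pverts G. \<Sum>u \<in> nbhd G v. (weight G v - weight G u)\<^sup>2"
  have "2 * ?W\<^sup>2 \<le> independence_number G * (\<Sum>v \<in> pverts G. weight G v * clique_op G (weight G) v)"
    by (intro motzkin_straus_local[OF G] less_imp_le[OF weight_pos])
  then have "?W * ?D \<le> 0"
    unfolding sum_weight_clique_op[OF G] eq[symmetric] by (simp add: algebra_simps power2_eq_square)
  then have "?D \<le> 0" using sum_weight_pos[OF G] by (simp add: mult_le_0_iff)
  then have D: "?D = 0" by (intro order_antisym sum_nonneg) simp_all
  show "weight G v = weight G u" if vu: "(v, u) \<in> parcs G"
  proof -
    have "(\<Sum>u \<in> nbhd G v. (weight G v - weight G u)\<^sup>2) = 0"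
      using D arc_pverts[OF G vu] finite_pverts[OF G] by (simp add: sum_nonneg sum_nonneg_eq_0_iff)
    then show ?thesis
      using vu finite_nbhd[OF G, of v] by (simp add: sum_nonneg_eq_0_iff mem_nbhd[OF G])
  qed
  show "clique_op G (marginal G) v = 2" if "v \<in> pverts G"
  proof (rule motzkin_straus_local_tight[OF G _ _ that])
    show "2 * ?W\<^sup>2 = independence_number G * (\<Sum>v \<in> pverts G. weight G v * clique_op G (weight G) v)"
      unfolding sum_weight_clique_op[OF G] D eq[symmetric] by (simp add: power2_eq_square)
  qed (rule weight_pos)
qed

section \<open>The case of equality\<close>

context
  fixes G :: "'a pair_pre_digraph"
  assumes G: "simple_graph G"
    and tight: "\<And>v. v \<in> pverts G \<Longrightarrow> clique_op G (marginal G) v = 2"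
begin

lemma tight_hits_le:
  assumes "S \<in> maximum_independent_sets G" "v \<in> pverts G"
  shows "card (S \<inter> insert v (nbhd G v)) \<le> 2"
  by (rule clique_op_marginal_tight(1)[OF G assms(2) tight[OF assms(2)] assms(1)])

lemma tight_card_completions:
  assumes S: "S \<in> maximum_independent_sets G" and v: "v \<in> S"
  shows "card (completions G (S - {v})) = clique_number_at G v"
proof -
  have "v \<in> pverts G" using maximum_independent_setD(4)[OF G S] v by blast
  then show ?thesis using clique_op_marginal_tight(2)[OF G _ tight S v] by simp
qed

text \<open>If u were adjacent to all completions, it would form with them a clique at s of more
  than c(s) vertices.\<close>

lemma tight_completion_nonneighbour:
  assumes S: "S \<in> maximum_independent_sets G" and s: "s \<in> S"
    and u: "u \<in> pverts G" "u \<notin> completions G (S - {s})"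
  obtains k where "k \<in> completions G (S - {s})" "(u, k) \<notin> parcs G"
proof -
  let ?C = "completions G (S - {s})"
  have "\<exists>k \<in> ?C. (u, k) \<notin> parcs G"
  proof (rule ccontr)
    assume "\<not> (\<exists>k \<in> ?C. (u, k) \<notin> parcs G)"
    then have arcs: "(u, k) \<in> parcs G \<and> (k, u) \<in> parcs G" if "k \<in> ?C" for k
      using that arc_sym[OF G] by simp
    have "clique G ?C" by (rule clique_completions[OF G S s])
    then have "clique G (insert u ?C)"
      using u(1) arcs unfolding clique_def by simp
    then have "card (insert u ?C) \<le> clique_number_at G s"
      using mem_completions_self[OF G S s] by (intro card_clique_le_clique_number_at[OF G]) simp_all
    then show False
      using u(2) finite_completions[OF G] tight_card_completions[OF S s] by simp
  qed
  then show thesis using that by blast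
qed

text \<open>Suppose v lies in no such set, and swap a neighbour s of v in S for a completion not
  adjacent to v. At most two hits become at most one, hence exactly one, and this last one can be
  swapped for v: a contradiction.\<close>

lemma tight_mem_some_maximum_independent_set:
  assumes v: "v \<in> pverts G"
  obtains S where "S \<in> maximum_independent_sets G" "v \<in> S"
proof -
  let ?N = "insert v (nbhd G v)"
  have "\<exists>S \<in> maximum_independent_sets G. v \<in> S"
  proof (rule ccontr)
    assume no: "\<not> (\<exists>S \<in> maximum_independent_sets G. v \<in> S)"
    have no_completion: "v \<notin> completions G (S - {s})" if "S \<in> maximum_independent_sets G" "s \<in> S" for S s
      using swap_completion[OF G that] no by blast
    obtain S where S: "S \<in> maximum_independent_sets G"
      using maximum_independent_sets_nonempty[OF G] by blast
    obtain s where s: "s \<in> S" "s \<in> ?N"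
      using maximum_independent_set_hits[OF G S v] by blast
    obtain k where k: "k \<in> completions G (S - {s})" "(v, k) \<notin> parcs G"
      by (rule tight_completion_nonneighbour[OF S s(1) v no_completion[OF S s(1)]])
    let ?S = "insert k (S - {s})"
    have S': "?S \<in> maximum_independent_sets G"
      by (rule swap_completion[OF G S s(1) k(1)])
    have "k \<noteq> v" using no S' by blast
    then have eq: "?S \<inter> ?N = S \<inter> ?N - {s}"
      using k(2) by (auto simp: mem_nbhd[OF G])
    have fin: "finite (S \<inter> ?N)" using maximum_independent_setD(3)[OF G S] by simp
    then have "card (?S \<inter> ?N) \<le> 1"
      unfolding eq using tight_hits_le[OF S v] s by simp
    moreover have "?S \<inter> ?N \<noteq> {}" by (rule maximum_independent_set_hits[OF G S' v])
    moreover have "finite (?S \<inter> ?N)" unfolding eq using fin by simp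
    ultimately have "card (?S \<inter> ?N) = 1" by (metis card_0_eq le_neq_implies_less less_one)
    then obtain j where j: "?S \<inter> ?N = {j}" by (meson card_1_singletonE)
    then have "j \<in> ?S" by blast
    then show False
      using no_completion[OF S'] private_completion[OF G S' _ v j] by blast
  qed
  then show thesis using that by blast
qed

text \<open>S - {v} stays the same when u replaces v, so one and the same clique of completions has
  both c(v) and c(u) vertices.\<close>

lemma tight_clique_number_at_completion:
  assumes S: "S \<in> maximum_independent_sets G" and v: "v \<in> S" and u: "u \<in> completions G (S - {v})"
  shows "clique_number_at G u = clique_number_at G v"
proof -
  have "insert u (S - {v}) - {u} = S - {v}" using u by (auto simp: completions_def)
  then show ?thesis
    using tight_card_completions[OF swap_completion[OF G S v u], of u] tight_card_completions[OF S v]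
    by simp
qed

text \<open>It suffices that some maximum independent set meets the closed neighbourhood of u in v
  only, as u can then replace v. If a set through v has a second hit s, there is no third, and s is
  swapped for a completion not adjacent to u.\<close>

lemma tight_clique_number_at_arc:
  assumes vu: "(v, u) \<in> parcs G"
  shows "clique_number_at G u = clique_number_at G v"
proof -
  have v: "v \<in> pverts G" and u: "u \<in> pverts G" and uv: "(u, v) \<in> parcs G"
    using arc_pverts[OF G vu] arc_sym[OF G vu] by simp_all
  let ?N = "insert u (nbhd G u)"
  have vN: "v \<in> ?N" using uv by (simp add: mem_nbhd[OF G])
  obtain S where S: "S \<in> maximum_independent_sets G" and vS: "v \<in> S"
    using v by (rule tight_mem_some_maximum_independent_set)
  have uS: "u \<notin> S" using maximum_independent_setD(5)[OF G S] vS uv by blast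
  have "\<exists>S \<in> maximum_independent_sets G. S \<inter> ?N = {v}"
  proof (cases "S \<inter> ?N = {v}")
    case False
    then obtain s where s: "s \<in> S" "s \<in> ?N" "s \<noteq> v" using vS vN by blast
    have "S \<inter> ?N = {v, s}"
    proof (rule sym, rule card_seteq)
      show "finite (S \<inter> ?N)" using maximum_independent_setD(3)[OF G S] by simp
      show "card (S \<inter> ?N) \<le> card {v, s}" using tight_hits_le[OF S u] s(3) by simp
    qed (use s vS vN in simp)
    \<comment> \<open>The neighbour v of u remains in S - {s}. Hence the completion k found next
      differs from u and brings no new hit.\<close>
    moreover have u_no: "u \<notin> completions G (S - {s})"
      using uv vS s(3) by (auto simp: completions_def mem_nbhd[OF G])
    moreover obtain k where k: "k \<in> completions G (S - {s})" "(u, k) \<notin> parcs G"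
      using u_no by (rule tight_completion_nonneighbour[OF S s(1) u])
    ultimately have "insert k (S - {s}) \<inter> ?N = {v}"
      using s(3) by (auto simp: mem_nbhd[OF G])
    then show ?thesis using swap_completion[OF G S s(1) k(1)] by blast
  qed (use S in blast)
  then obtain S' where S': "S' \<in> maximum_independent_sets G" "S' \<inter> ?N = {v}" by blast
  then have "v \<in> S'" by blast
  with S' show ?thesis
    using tight_clique_number_at_completion private_completion[OF G _ _ u] by blast
qed

end

text \<open>The weight determines the sum of degree and c, and both the weight and c are constant
  along arcs.\<close>

lemma equality_degree_clique_arc:
  assumes G: "simple_graph G" and eq: "2 * sum (weight G) (pverts G) = independence_number G"
    and vu: "(v, u) \<in> parcs G"
  shows "degree G v = degree G u" "clique_number_at G v = clique_number_at G u"
proof -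
  show c: "clique_number_at G v = clique_number_at G u"
    using tight_clique_number_at_arc[OF G sum_weight_tight(2)[OF G eq] vu] by simp
  have "1 / weight G v = 1 / weight G u" using sum_weight_tight(1)[OF G eq vu] by simp
  then have "real (degree G v) + real (clique_number_at G v) = real (degree G u) + real (clique_number_at G u)"
    by (simp add: weight_def)
  then show "degree G v = degree G u" using c by simp
qed

section \<open>Disjoint unions\<close>

context
  fixes G :: "'a pair_pre_digraph" and I :: "'i set" and H :: "'i \<Rightarrow> 'a pair_pre_digraph"
  assumes G: "simple_graph G" and I: "finite I" and H: "\<And>i. i \<in> I \<Longrightarrow> simple_graph (H i)"
    and union: "is_disjoint_union G I H"
begin

lemma union_pverts: "pverts G = (\<Union>i \<in> I. pverts (H i))"
  and union_parcs: "parcs G = (\<Union>i \<in> I. parcs (H i))"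
  using union by (simp_all add: is_disjoint_union_def)

lemma summand_unique:
  assumes "i \<in> I" "j \<in> I" "v \<in> pverts (H i)" "v \<in> pverts (H j)"
  shows "i = j"
  using union assms by (auto simp: is_disjoint_union_def disjoint_family_on_def)

text \<open>The summand that contributes the arc also contains v, so by disjointness it is
  \<open>H i\<close>.\<close>

lemma arc_summand:
  assumes i: "i \<in> I" and v: "v \<in> pverts (H i)"
  shows "(v, u) \<in> parcs G \<longleftrightarrow> (v, u) \<in> parcs (H i)"
proof
  assume "(v, u) \<in> parcs G"
  then obtain j where j: "j \<in> I" "(v, u) \<in> parcs (H j)" by (auto simp: union_parcs)
  then have "v \<in> pverts (H j)" using arc_pverts[OF H] by simp
  then show "(v, u) \<in> parcs (H i)" using summand_unique[OF i j(1) v] j(2) by simp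
qed (use i in \<open>auto simp: union_parcs\<close>)

lemma degree_summand:
  assumes "i \<in> I" "v \<in> pverts (H i)"
  shows "degree G v = degree (H i) v"
  using arc_summand[OF assms] by (simp add: degree_eq_card_nbhd nbhd_def)

text \<open>All other vertices of a clique through v are neighbours of v and hence lie in the same
  summand.\<close>

lemma clique_summand:
  assumes i: "i \<in> I" and v: "v \<in> pverts (H i)" and "v \<in> K"
  shows "clique G K \<longleftrightarrow> clique (H i) K"
proof
  assume K: "clique G K"
  have "K \<subseteq> pverts (H i)"
  proof
    fix u assume "u \<in> K"
    then show "u \<in> pverts (H i)"
      using K v \<open>v \<in> K\<close> arc_summand[OF i v, of u] arc_pverts[OF H[OF i], of v u]
      by (cases "u = v") (auto simp: clique_def)
  qed
  with K show "clique (H i) K"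
    using arc_summand[OF i] unfolding clique_def by (meson subsetD)
next
  assume K: "clique (H i) K"
  have "pverts (H i) \<subseteq> pverts G" using i by (auto simp: union_pverts)
  with K show "clique G K"
    using arc_summand[OF i] unfolding clique_def by (meson subsetD subset_trans)
qed

lemma clique_number_at_summand:
  assumes "i \<in> I" "v \<in> pverts (H i)"
  shows "clique_number_at G v = clique_number_at (H i) v"
proof -
  have "{K. clique G K \<and> v \<in> K} = {K. clique (H i) K \<and> v \<in> K}"
    using clique_summand[OF assms] by blast
  then show ?thesis by (simp add: clique_number_at_def)
qed

lemma sum_summands: "(\<Sum>v \<in> pverts G. g v) = (\<Sum>i \<in> I. \<Sum>v \<in> pverts (H i). g v)"
  unfolding union_pverts
  using I finite_pverts[OF H] summand_unique by (intro sum.UNION_disjoint) blast+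

lemma sum_weight_summands:
  "sum (weight G) (pverts G) = (\<Sum>i \<in> I. sum (weight (H i)) (pverts (H i)))"
  unfolding sum_summands
  by (intro sum.cong) (simp_all add: weight_def degree_summand clique_number_at_summand)

text \<open>A maximum independent set of G splits into independent sets of the summands. Conversely,
  maximum independent sets of the summands have an independent union, as no arc joins two
  summands.\<close>

lemma independence_number_summands: "independence_number G = (\<Sum>i \<in> I. independence_number (H i))"
proof (rule order_antisym)
  obtain S where S: "S \<in> maximum_independent_sets G"
    using maximum_independent_sets_nonempty[OF G] by blast
  note S' = maximum_independent_setD[OF G S]
  have "S = (\<Union>i \<in> I. S \<inter> pverts (H i))" using S'(4) by (auto simp: union_pverts)
  then have "card S = card (\<Union>i \<in> I. S \<inter> pverts (H i))" by simp
  also have "\<dots> \<le> (\<Sum>i \<in> I. card (S \<inter> pverts (H i)))" by (rule card_UN_le[OF I])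
  also have "\<dots> \<le> (\<Sum>i \<in> I. independence_number (H i))"
  proof (rule sum_mono)
    fix i assume i: "i \<in> I"
    have "independent_set (H i) (S \<inter> pverts (H i))"
      using S'(5) arc_summand[OF i] by (auto simp: independent_set_def)
    then show "card (S \<inter> pverts (H i)) \<le> independence_number (H i)"
      by (rule card_le_independence_number[OF H[OF i]])
  qed
  finally show "independence_number G \<le> (\<Sum>i \<in> I. independence_number (H i))"
    using S'(2) by simp
next
  have "\<exists>S. S \<in> maximum_independent_sets (H i)" if "i \<in> I" for i
    using maximum_independent_sets_nonempty[OF H[OF that]] by blast
  then obtain T where T: "T i \<in> maximum_independent_sets (H i)" if "i \<in> I" for i by metis
  note T' = maximum_independent_setD[OF H T]
  have "independent_set G (\<Union>i \<in> I. T i)"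
    unfolding independent_set_def
  proof (intro conjI ballI)
    show "(\<Union>i \<in> I. T i) \<subseteq> pverts G" using T'(4) by (force simp: union_pverts)
    fix u v assume "u \<in> (\<Union>i \<in> I. T i)" "v \<in> (\<Union>i \<in> I. T i)"
    then obtain i j where ij: "i \<in> I" "j \<in> I" "u \<in> T i" "v \<in> T j" by blast
    then have u: "u \<in> pverts (H i)" and v: "v \<in> pverts (H j)" using T'(4) by blast+
    show "(u, v) \<notin> parcs G"
    proof
      assume "(u, v) \<in> parcs G"
      then have uv: "(u, v) \<in> parcs (H i)" using arc_summand[OF ij(1) u] by simp
      then have "v \<in> pverts (H i)" using arc_pverts[OF H[OF ij(1)]] by simp
      then have "i = j" using summand_unique ij v by blast
      then show False using T'(5)[OF ij(1) ij(1)] ij uv by blast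
    qed
  qed
  then have "card (\<Union>i \<in> I. T i) \<le> independence_number G"
    by (rule card_le_independence_number[OF G])
  moreover have "card (\<Union>i \<in> I. T i) = (\<Sum>i \<in> I. card (T i))"
  proof (rule card_UN_disjoint[OF I])
    show "\<forall>i \<in> I. finite (T i)" using T'(3) by blast
    show "\<forall>i \<in> I. \<forall>j \<in> I. i \<noteq> j \<longrightarrow> T i \<inter> T j = {}"
      using T'(4) summand_unique by blast
  qed
  moreover have "(\<Sum>i \<in> I. card (T i)) = (\<Sum>i \<in> I. independence_number (H i))"
    using T'(2) by (intro sum.cong) simp_all
  ultimately show "(\<Sum>i \<in> I. independence_number (H i)) \<le> independence_number G" by simp
qed

end

section \<open>Extremal summands and the two directions of the equality criterion\<close>

lemma sum_weight_ge_of_regular: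
  assumes H: "simple_graph H" and reg: "regular H (max_degree H)"
  shows "real (card (pverts H)) / (real (max_degree H) + real (clique_number H) + 1) \<le> sum (weight H) (pverts H)"
proof -
  have "(\<Sum>v \<in> pverts H. 1 / (real (max_degree H) + real (clique_number H) + 1)) \<le> sum (weight H) (pverts H)"
  proof (rule sum_mono)
    fix v assume v: "v \<in> pverts H"
    then have "degree H v = max_degree H" using reg by (simp add: regular_def)
    \<comment> \<open>Only c(v) <= omega is at hand, as v may lie in no largest clique of H. An
      inequality suffices, because \<open>sum_weight_le\<close> supplies the opposite one.\<close>
    then show "1 / (real (max_degree H) + real (clique_number H) + 1) \<le> weight H v"
      using clique_number_at_le_clique_number[OF H v] unfolding weight_def
      by (intro divide_left_mono) (simp_all add: add_nonneg_pos)
  qed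
  then show ?thesis by simp
qed

lemma max_degree_eq:
  assumes "simple_graph H" and "\<And>v. v \<in> pverts H \<Longrightarrow> degree H v = d"
  shows "max_degree H = d"
proof -
  have "degree H ` pverts H = {d}"
    using assms(2) pverts_nonempty[OF assms(1)] by (auto simp: image_def)
  then show ?thesis by (simp add: max_degree_def)
qed

lemma clique_number_eq:
  assumes H: "simple_graph H" and c: "\<And>v. v \<in> pverts H \<Longrightarrow> clique_number_at H v = c"
  shows "clique_number H = c"
proof (rule order_antisym)
  obtain v where v: "v \<in> pverts H" using pverts_nonempty[OF H] by blast
  then show "c \<le> clique_number H"
    using clique_number_at_le_clique_number[OF H v] c[OF v] by simp
  have "card K \<le> c" if K: "clique H K" for K
  proof (cases "K = {}")
    case False
    then obtain u where u: "u \<in> K" by blast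
    then have "u \<in> pverts H" using K unfolding clique_def by blast
    then show ?thesis using card_clique_le_clique_number_at[OF H K u] c by simp
  qed simp
  moreover have "clique H {}" by (simp add: clique_def)
  ultimately show "clique_number H \<le> c"
    unfolding clique_number_def using finite_cliques[OF H] by (intro Max.boundedI) auto
qed

text \<open>For each summand alpha is at most twice the sum of the weights, and both quantities are
  additive over the union.\<close>

lemma equality_if_extremal_summands:
  assumes G: "simple_graph G" and I: "finite I" and union: "is_disjoint_union G I H"
    and H: "\<And>i. i \<in> I \<Longrightarrow> simple_graph (H i)"
    and reg: "\<And>i. i \<in> I \<Longrightarrow> regular (H i) (max_degree (H i))"
    and ext: "\<And>i. i \<in> I \<Longrightarrow> real (independence_number (H i)) =
      2 * real (card (pverts (H i))) / (real (max_degree (H i)) + real (clique_number (H i)) + 1)"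
  shows "2 * sum (weight G) (pverts G) = independence_number G"
proof (rule order_antisym)
  show "2 * sum (weight G) (pverts G) \<le> independence_number G" by (rule sum_weight_le[OF G])
  have "real (independence_number (H i)) \<le> 2 * sum (weight (H i)) (pverts (H i))" if "i \<in> I" for i
    using sum_weight_ge_of_regular[OF H[OF that] reg[OF that]] ext[OF that] by simp
  then have "(\<Sum>i \<in> I. real (independence_number (H i))) \<le> (\<Sum>i \<in> I. 2 * sum (weight (H i)) (pverts (H i)))"
    by (rule sum_mono)
  then show "independence_number G \<le> 2 * sum (weight G) (pverts G)"
    by (simp add: independence_number_summands[OF G I H union] sum_weight_summands[OF G I H union]
        sum_distrib_left)
qed

text \<open>Arcs stay inside the classes of equal degree and c, so these classes, connected or not,
  form a disjoint union. On each class the degree is the maximum degree and c is the clique number,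
  so all weights are equal.\<close>

lemma extremal_summands_if_equality:
  assumes G: "simple_graph G" and eq: "2 * sum (weight G) (pverts G) = independence_number G"
  obtains k :: nat and H :: "nat \<Rightarrow> 'a pair_pre_digraph" where "k \<ge> 1" "is_disjoint_union G {1..k} H"
    "\<And>i. i \<in> {1..k} \<Longrightarrow> simple_graph (H i) \<and> regular (H i) (max_degree (H i)) \<and>
      real (independence_number (H i)) =
        2 * real (card (pverts (H i))) / (real (max_degree (H i)) + real (clique_number (H i)) + 1)"
proof -
  define key where "key v = (degree G v, clique_number_at G v)" for v
  define k where "k = card (key ` pverts G)"
  have fin: "finite (key ` pverts G)" using finite_pverts[OF G] by simp
  \<comment> \<open>The function \<open>h\<close> numbers the pairs that occur, so
    \<open>h i\<close> consists of the common degree and c on \<open>C i\<close>, and no class is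
    empty.\<close>
  then obtain h where h: "bij_betw h {1..k} (key ` pverts G)"
    using ex_bij_betw_nat_finite_1[OF fin] by (auto simp: k_def)
  define C where "C i = {v \<in> pverts G. key v = h i}" for i
  define H where "H i = induced G (C i)" for i
  have C_nonempty: "C i \<noteq> {}" if i: "i \<in> {1..k}" for i
  proof -
    have "h i \<in> key ` pverts G" using h i by (rule bij_betwE[rule_format])
    then show ?thesis by (auto simp: C_def)
  qed
  have C_sub: "C i \<subseteq> pverts G" for i by (auto simp: C_def)
  have simple: "simple_graph (H i)" if "i \<in> {1..k}" for i
    unfolding H_def by (rule simple_graph_induced[OF G C_sub C_nonempty[OF that]])
  have cover: "\<exists>i \<in> {1..k}. v \<in> C i" if v: "v \<in> pverts G" for v
  proof -
    have "key v \<in> h ` {1..k}" using h v by (simp add: bij_betw_def)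
    then show ?thesis using v by (auto simp: C_def)
  qed
  have key_arc: "key v = key u" if "(v, u) \<in> parcs G" for v u
    using equality_degree_clique_arc[OF G eq that] by (simp add: key_def)
  have union: "is_disjoint_union G {1..k} H"
    unfolding is_disjoint_union_def
  proof (intro conjI)
    have "C i \<inter> C j = {}" if "i \<in> {1..k}" "j \<in> {1..k}" "i \<noteq> j" for i j
    proof -
      have "h i \<noteq> h j" using inj_onD[OF bij_betw_imp_inj_on[OF h]] that by metis
      then show ?thesis by (auto simp: C_def)
    qed
    then show "disjoint_family_on (\<lambda>i. pverts (H i)) {1..k}"
      by (simp add: disjoint_family_on_def H_def)
    show "pverts G = (\<Union>i \<in> {1..k}. pverts (H i))"
    proof (rule subset_antisym)
      show "pverts G \<subseteq> (\<Union>i \<in> {1..k}. pverts (H i))"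
        using cover unfolding H_def pverts_induced by (intro subsetI) (simp only: UN_iff)
      show "(\<Union>i \<in> {1..k}. pverts (H i)) \<subseteq> pverts G"
        unfolding H_def pverts_induced by (rule UN_least) (rule C_sub)
    qed
    show "parcs G = (\<Union>i \<in> {1..k}. parcs (H i))"
    proof (intro set_eqI iffI)
      fix e assume e: "e \<in> parcs G"
      obtain v u where vu: "e = (v, u)" by (cases e)
      then have V: "v \<in> pverts G" "u \<in> pverts G" using arc_pverts[OF G] e by simp_all
      obtain i where i: "i \<in> {1..k}" "v \<in> C i" using cover[OF V(1)] by blast
      then have "u \<in> C i" using key_arc e vu V by (simp add: C_def)
      then have "e \<in> parcs (H i)" using i(2) e vu by (simp add: H_def)
      then show "e \<in> (\<Union>i \<in> {1..k}. parcs (H i))" using i(1) by (rule UN_I[rotated])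
    qed (auto simp: H_def induced_def)
  qed
  have "key ` pverts G \<noteq> {}" using pverts_nonempty[OF G] by simp
  then have "k \<ge> 1" using fin by (simp add: k_def Suc_le_eq card_gt_0_iff)
  note summands = G finite_atLeastAtMost simple union
  have deg: "degree (H i) v = fst (h i)" if i: "i \<in> {1..k}" and v: "v \<in> pverts (H i)" for i v
    using degree_summand[OF summands i v] v by (auto simp: H_def C_def key_def prod_eq_iff)
  have clq: "clique_number_at (H i) v = snd (h i)" if i: "i \<in> {1..k}" and v: "v \<in> pverts (H i)" for i v
    using clique_number_at_summand[OF summands i v] v by (auto simp: H_def C_def key_def prod_eq_iff)
  have max_deg: "max_degree (H i) = fst (h i)" if i: "i \<in> {1..k}" for i
    using max_degree_eq[OF simple[OF i]] deg[OF i] by blast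
  have clq_num: "clique_number (H i) = snd (h i)" if i: "i \<in> {1..k}" for i
    using clique_number_eq[OF simple[OF i]] clq[OF i] by blast
  \<comment> \<open>The deficits of the summands in the inequality add up to that of G, which is
    zero. None is negative, so each of them is zero.\<close>
  have "(\<Sum>i \<in> {1..k}. real (independence_number (H i)) - 2 * sum (weight (H i)) (pverts (H i))) = 0"
    using eq independence_number_summands[OF summands] sum_weight_summands[OF summands]
    by (simp add: sum_subtractf sum_distrib_left[symmetric])
  moreover have "0 \<le> real (independence_number (H i)) - 2 * sum (weight (H i)) (pverts (H i))"
    if "i \<in> {1..k}" for i
    using sum_weight_le[OF simple[OF that]] by simp
  ultimately have "real (independence_number (H i)) - 2 * sum (weight (H i)) (pverts (H i)) = 0"
    if "i \<in> {1..k}" for i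
    using that sum_nonneg_eq_0_iff[of "{1..k}"
        "\<lambda>i. real (independence_number (H i)) - 2 * sum (weight (H i)) (pverts (H i))"] by simp
  moreover have "sum (weight (H i)) (pverts (H i)) =
      real (card (pverts (H i))) / (real (max_degree (H i)) + real (clique_number (H i)) + 1)"
    if i: "i \<in> {1..k}" for i
    by (simp add: weight_def deg[OF i] clq[OF i] max_deg[OF i] clq_num[OF i])
  moreover have "regular (H i) (max_degree (H i))" if i: "i \<in> {1..k}" for i
    by (simp add: regular_def deg[OF i] max_deg[OF i])
  ultimately show thesis
    using that[OF \<open>k \<ge> 1\<close> union] simple by simp
qed

theorem theorem3p1:
  fixes G :: "'a pair_pre_digraph"
  assumes "simple_graph G"
  shows "real (independence_number G) \<ge>
           (\<Sum>v \<in> pverts G. 2 / (real (degree G v) + real (clique_number_at G v) + 1))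
    \<and> (real (independence_number G) =
           (\<Sum>v \<in> pverts G. 2 / (real (degree G v) + real (clique_number_at G v) + 1))
       \<longleftrightarrow>
       (\<exists>(k::nat) (H :: nat \<Rightarrow> 'a pair_pre_digraph).
          k \<ge> 1 \<and>
          is_disjoint_union G {1..k} H \<and>
          (\<forall>i \<in> {1..k}.
             simple_graph (H i) \<and>
             regular (H i) (max_degree (H i)) \<and>
             real (independence_number (H i)) =
               2 * real (card (pverts (H i))) /
                 (real (max_degree (H i)) + real (clique_number (H i)) + 1))))"
proof (rule conjI)
  have sum_eq: "(\<Sum>v \<in> pverts G. 2 / (real (degree G v) + real (clique_number_at G v) + 1)) = 2 * sum (weight G) (pverts G)"
    by (simp add: weight_def sum_distrib_left)
  show "real (independence_number G) \<ge>
      (\<Sum>v \<in> pverts G. 2 / (real (degree G v) + real (clique_number_at G v) + 1))"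
    unfolding sum_eq by (rule sum_weight_le[OF assms])
  show "real (independence_number G) =
           (\<Sum>v \<in> pverts G. 2 / (real (degree G v) + real (clique_number_at G v) + 1))
       \<longleftrightarrow>
       (\<exists>(k::nat) (H :: nat \<Rightarrow> 'a pair_pre_digraph).
          k \<ge> 1 \<and>
          is_disjoint_union G {1..k} H \<and>
          (\<forall>i \<in> {1..k}.
             simple_graph (H i) \<and>
             regular (H i) (max_degree (H i)) \<and>
             real (independence_number (H i)) =
               2 * real (card (pverts (H i))) /
                 (real (max_degree (H i)) + real (clique_number (H i)) + 1)))"
    unfolding sum_eq
  proof (rule iffI, goal_cases)
    case 1
    then have eq: "2 * sum (weight G) (pverts G) = independence_number G" by simp
    show ?case
    proof (rule extremal_summands_if_equality[OF assms eq])
      fix k :: nat and H :: "nat \<Rightarrow> 'a pair_pre_digraph"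
      assume "k \<ge> 1" "is_disjoint_union G {1..k} H"
        "\<And>i. i \<in> {1..k} \<Longrightarrow> simple_graph (H i) \<and> regular (H i) (max_degree (H i)) \<and>
          real (independence_number (H i)) =
            2 * real (card (pverts (H i))) / (real (max_degree (H i)) + real (clique_number (H i)) + 1)"
      then show ?case by (intro exI[of _ k] exI[of _ H] conjI ballI) simp_all
    qed
  next
    case 2
    then obtain k :: nat and H :: "nat \<Rightarrow> 'a pair_pre_digraph"
      where union: "is_disjoint_union G {1..k} H" and
        "\<And>i. i \<in> {1..k} \<Longrightarrow> simple_graph (H i) \<and> regular (H i) (max_degree (H i)) \<and>
          real (independence_number (H i)) =
            2 * real (card (pverts (H i))) / (real (max_degree (H i)) + real (clique_number (H i)) + 1)"
      by (elim exE conjE) blast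
    then have "2 * sum (weight G) (pverts G) = independence_number G"
      by (intro equality_if_extremal_summands[OF assms finite_atLeastAtMost union]) simp_all
    then show ?case by simp
  qed
qed

end
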